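(* If $r\ge 15$ is an integer, then $$ \gamma_r(3) > c\cdot 2^{3r/8}, $$ where $c=(16464)^{1/8}$ ($\approx 3.3656$).
   Context: Let $\mathbb{F}_2^r$ be the $r$-dimensional vector space over the two-element field, and let $0\le d\le r$ be an integer. A subset $C\subseteq\mathbb{F}_2^r$ is called $d$-complete if for every $v\in\mathbb{F}_2^r$ there exists a linear subspace $L_v\le\mathbb{F}_2^r$ of dimension $d$ such that $v+(L_v\setminus\{0\})\subseteq C$. By $\gamma_r(d)$ we denote the smallest possible size of a $d$-complete subset of $\mathbb{F}_2^r$. *)

theory Defs
  imports "HOL-Analysis.Analysis" "HOL-Library.Z2"
begin

text \<open>The type \<open>bit\<close> is the two-element field, so \<open>bit ^ 'r\<close> is the space of dimension
  \<open>r = CARD('r)\<close> over it. The library interpretation \<open>vec\<close> provides linear subspaces and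
  dimension over an arbitrary field, here with scalars in \<open>bit\<close>.\<close>

definition d_complete :: "nat \<Rightarrow> (bit ^ 'r::finite) set \<Rightarrow> bool" where
  "d_complete d C \<longleftrightarrow>
     (\<forall>v. \<exists>L. vec.subspace L \<and> vec.dim L = d \<and> (\<lambda>x. v + x) ` (L - {0}) \<subseteq> C)"

text \<open>The dimension \<open>r\<close> is passed as a type argument, as in \<open>\<gamma> TYPE('r) d\<close>.
  The value is meaningful for \<open>d \<le> CARD('r)\<close>; see \<open>\<gamma>_attained\<close> and \<open>\<gamma>_le\<close>.\<close>

definition \<gamma> :: "'r::finite itself \<Rightarrow> nat \<Rightarrow> nat" where
  "\<gamma> _ d = (LEAST k. \<exists>C :: (bit ^ 'r::finite) set. d_complete d C \<and> card C = k)"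

lemma finite_bit_vec: "finite (C :: (bit ^ 'r::finite) set)"
proof -
  have "finite (UNIV :: bit set)"
    by (rule finite_subset[of _ "{0, 1}"]) (auto intro: bit.exhaust)
  then have "finite {f :: 'r \<Rightarrow> bit. \<forall>i. f i \<in> UNIV}"
    using finite_set_of_finite_funs[of "UNIV :: 'r set" "UNIV :: bit set"] by simp
  then have "finite (range (vec_lambda :: ('r \<Rightarrow> bit) \<Rightarrow> bit ^ 'r))"
    by simp
  moreover have "range (vec_lambda :: ('r \<Rightarrow> bit) \<Rightarrow> bit ^ 'r) = UNIV"
    by (metis surjI vec_nth_inverse)
  ultimately show ?thesis
    by (metis finite_subset subset_UNIV)
qed

lemma d_complete_UNIV:
  assumes "d \<le> CARD('r::finite)"
  shows "d_complete d (UNIV :: (bit ^ 'r::finite) set)"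
proof -
  let ?B = "cart_basis :: (bit ^ 'r::finite) set"
  obtain B where B: "B \<subseteq> ?B" "card B = d"
    using assms by (metis obtain_subset_with_card_n card_cart_basis)
  have "vec.independent B"
    using B(1) independent_cart_basis vec.independent_mono by blast
  then have "vec.subspace (vec.span B)" "vec.dim (vec.span B) = d"
    using B(2) vec.dim_span_eq_card_independent by auto
  then show ?thesis
    unfolding d_complete_def by blast
qed

lemma \<gamma>_attained:
  assumes "d \<le> CARD('r::finite)"
  shows "\<exists>C :: (bit ^ 'r::finite) set. d_complete d C \<and> card C = \<gamma> TYPE('r::finite) d"
  unfolding \<gamma>_def by (rule LeastI) (use d_complete_UNIV[OF assms] in blast)

lemma \<gamma>_le:
  fixes C :: "(bit ^ 'r::finite) set"
  assumes "d_complete d C"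
  shows "\<gamma> TYPE('r) d \<le> card C"
  unfolding \<gamma>_def by (rule Least_le) (use assms in blast)

end

theory Submission
  imports Defs
begin

text \<open>Let \<open>n = |C|\<close> and consider, for a direction \<open>w \<noteq> 0\<close>, the set \<open>V\<^sub>w\<close> of points \<open>v \<notin> C\<close> with
  \<open>w \<in> L\<^sub>v\<close>. Since \<open>v + w \<in> C\<close>, it has at most \<open>n\<close> elements. On the other hand
  \<open>v + (L\<^sub>v - {0, w})\<close> consists of three of the \<open>k\<^sub>w\<close> pairs \<open>{p, p + w} \<subseteq> C\<close>, and these
  determine \<open>v\<close>, so \<open>V\<^sub>w\<close> has at most \<open>k\<^sub>w choose 3\<close> elements. With \<open>x\<^sup>3 = 6 n\<close> both bounds
  together give \<open>|V\<^sub>w| \<le> k\<^sub>w x\<^sup>2 / 6\<close>. Every \<open>v\<close> has seven directions and the \<open>k\<^sub>w\<close> sum to at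
  most \<open>n choose 2\<close>, hence \<open>7 (2\<^sup>r - n) \<le> n (n - 1) x\<^sup>2 / 12\<close>. For \<open>r \<ge> 15\<close> the term \<open>7 n\<close> is
  absorbed by \<open>n x\<^sup>2 / 12\<close>, and cubing \<open>84 \<cdot> 2\<^sup>r < n\<^sup>2 x\<^sup>2\<close> gives the constant \<open>84\<^sup>3 / 36 = 16464\<close>.\<close>

section \<open>Linear algebra over the two-element field\<close>

lemma bit_vec_add_self [simp]: "(x :: bit ^ 'r::finite) + x = 0"
  by (simp add: vec_eq_iff)

lemma bit_vec_double [simp]: "2 * x = (0 :: bit ^ 'r::finite)"
  by (simp add: mult_2)

lemma bit_vec_add_self_left [simp]: "x + (x + y) = (y :: bit ^ 'r::finite)"
  by (simp flip: add.assoc)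

lemma bit_vec_add_eq_0_iff [simp]: "x + y = 0 \<longleftrightarrow> y = (x :: bit ^ 'r::finite)"
  by (metis add.right_neutral bit_vec_add_self bit_vec_add_self_left)

lemma bit_vec_add_cancel: "(z + x) + (z + y) = x + (y :: bit ^ 'r::finite)"
  by (metis add.assoc add.left_commute bit_vec_add_self_left)

text \<open>A new independent vector \<open>b\<close> doubles the span: its only nonzero multiple is
  \<open>b\<close> itself, so \<open>vec.span B\<close> is joined by just one further, disjoint
  translate.\<close>

lemma card_span_bit:
  fixes B :: "(bit ^ 'r::finite) set"
  assumes "vec.independent B"
  shows "card (vec.span B) = 2 ^ card B"
proof -
  have "finite B" by (rule finite_bit_vec)
  then show ?thesis using assms
  proof (induction B rule: finite_induct)
    case empty
    then show ?case by simp
  next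
    case (insert b B)
    let ?S = "vec.span B"
    have b: "b \<notin> ?S" and IH: "card ?S = 2 ^ card B"
      using insert vec.independent_insert[of b B] by auto
    have eq: "vec.span (insert b B) = ?S \<union> (+) b ` ?S"
    proof (intro set_eqI iffI)
      fix x assume "x \<in> vec.span (insert b B)"
      then obtain k where k: "x - k *s b \<in> ?S" using vec.span_breakdown_eq by blast
      show "x \<in> ?S \<union> (+) b ` ?S"
      proof (cases k)
        case zero
        with k show ?thesis by simp
      next
        case one
        with k have "x - b \<in> ?S" by simp
        then have "b + (x - b) \<in> (+) b ` ?S" by (rule imageI)
        then show ?thesis by simp
      qed
    next
      fix x assume "x \<in> ?S \<union> (+) b ` ?S"
      moreover have "?S \<subseteq> vec.span (insert b B)" by (rule vec.span_mono) auto
      moreover have "b \<in> vec.span (insert b B)" by (rule vec.span_base) simp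
      ultimately show "x \<in> vec.span (insert b B)"
        using vec.span_add by blast
    qed
    have "b + y \<notin> ?S" if "y \<in> ?S" for y
      using b vec.span_add_eq2 that by blast
    then have "?S \<inter> (+) b ` ?S = {}" by auto
    then show ?case
      using insert.hyps IH unfolding eq
      by (subst card_Un_disjoint) (auto simp: finite_bit_vec card_image)
  qed
qed

lemma card_subspace_bit:
  fixes L :: "(bit ^ 'r::finite) set"
  assumes "vec.subspace L"
  shows "card L = 2 ^ vec.dim L"
proof -
  obtain B where "vec.independent B" "B \<subseteq> L" "L \<subseteq> vec.span B" "card B = vec.dim L"
    using vec.basis_exists by blast
  then show ?thesis
    using card_span_bit[of B] vec.span_subspace[OF _ _ assms] by metis
qed

lemma card_bit: "CARD(bit) = 2"
proof -
  have "(UNIV :: bit set) = {0, 1}" by (auto intro: bit.exhaust)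
  then have "CARD(bit) = card {0, 1 :: bit}" by (rule arg_cong)
  then show ?thesis by simp
qed

section \<open>Pairs with prescribed sum\<close>

text \<open>In characteristic two sum and difference agree: for \<open>w \<noteq> 0\<close> these
  are the sets \<open>{u, u + w}\<close> inside \<open>C\<close>.\<close>

definition pairs_with_sum :: "(bit ^ 'r::finite) set \<Rightarrow> bit ^ 'r \<Rightarrow> (bit ^ 'r) set set" where
  "pairs_with_sum C w = {p. p \<subseteq> C \<and> card p = 2 \<and> \<Sum>p = w}"

lemma finite_pairs_with_sum: "finite (pairs_with_sum C w)"
  by (rule finite_subset[of _ "Pow C"]) (auto simp: finite_bit_vec pairs_with_sum_def)

text \<open>A two-element set has only one sum, so the families for different \<open>w\<close> are
  disjoint.\<close>

lemma sum_card_pairs_with_sum_le: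
  "(\<Sum>w\<in>W. card (pairs_with_sum C w)) \<le> card C choose 2"
proof -
  have "(\<Sum>w\<in>W. card (pairs_with_sum C w)) = card (\<Union>w\<in>W. pairs_with_sum C w)"
    by (rule card_UN_disjoint[symmetric])
       (auto simp: finite_bit_vec finite_pairs_with_sum, auto simp: pairs_with_sum_def)
  also have "\<dots> \<le> card {p. p \<subseteq> C \<and> card p = 2}"
    by (rule card_mono) (auto simp: finite_bit_vec pairs_with_sum_def)
  also have "\<dots> = card C choose 2"
    by (simp add: n_subsets finite_bit_vec)
  finally show ?thesis .
qed

section \<open>Points sharing a direction\<close>

text \<open>Sending \<open>v\<close> to its three pairs \<open>T v\<close> is injective on
  \<open>V\<close>: their union \<open>U v\<close> recovers \<open>L v\<close>, and then
  \<open>v\<close> up to adding \<open>w\<close>.\<close>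

lemma card_fixed_direction_le_choose:
  fixes C V :: "(bit ^ 'r::finite) set" and L :: "bit ^ 'r \<Rightarrow> (bit ^ 'r) set"
  assumes "w \<noteq> 0"
    and V: "\<And>v. v \<in> V \<Longrightarrow> v \<notin> C" "\<And>v. v \<in> V \<Longrightarrow> w \<in> L v"
    and L: "\<And>v. vec.subspace (L v)" "\<And>v. card (L v) = 8"
      "\<And>v x. x \<in> L v \<Longrightarrow> x \<noteq> 0 \<Longrightarrow> v + x \<in> C"
  shows "card V \<le> card (pairs_with_sum C w) choose 3"
proof -
  define U where "U v = (+) v ` (L v - {0, w})" for v
  define T where "T v = (\<lambda>u. {u, w + u}) ` U v" for v
  have U_iff: "u \<in> U v \<longleftrightarrow> v + u \<in> L v \<and> u \<noteq> v \<and> u \<noteq> v + w" for u v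
    unfolding U_def by (auto simp: image_iff intro!: bexI[of _ "v + u"])
  \<comment> \<open>Adding \<open>w\<close> maps \<open>L v\<close> to itself and swaps
    \<open>0\<close> and \<open>w\<close>.\<close>
  have U_add: "w + u \<in> U v" if "v \<in> V" "u \<in> U v" for u v
  proof -
    have "v + (w + u) \<in> L v"
      using vec.subspace_add[OF L(1)] V(2)[OF that(1)] that(2)
      by (metis U_iff add.left_commute)
    moreover have "w + u \<noteq> v" "w + u \<noteq> v + w"
      using that(2) by (metis U_iff add.commute bit_vec_add_self_left)+
    ultimately show ?thesis by (simp add: U_iff)
  qed
  have Union_T: "\<Union>(T v) = U v" if "v \<in> V" for v
    using U_add[OF that] by (auto simp: T_def)
  have T_mem: "p \<in> pairs_with_sum C w" if v: "v \<in> V" and p: "p \<in> T v" for p v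
  proof -
    obtain u where u: "u \<in> U v" "p = {u, w + u}" using p unfolding T_def by blast
    have "u \<noteq> w + u" using \<open>w \<noteq> 0\<close> by simp
    moreover have "U v \<subseteq> C" unfolding U_def using L(3) by auto
    ultimately show ?thesis
      using u U_add[OF v] by (auto simp: pairs_with_sum_def add.left_commute)
  qed
  have card_T: "card (T v) = 3" if "v \<in> V" for v
  proof -
    have "0 \<in> L v" "w \<in> L v" using vec.subspace_0[OF L(1)] V(2)[OF that] by auto
    then have "card (U v) = 6"
      using \<open>w \<noteq> 0\<close> unfolding U_def
      by (subst card_image) (auto simp: card_Diff_subset L(2))
    moreover have "2 * card (T v) = card (\<Union>(T v))"
    proof (rule card_partition)
      show "card p = 2" if "p \<in> T v" for p
        using T_mem[OF \<open>v \<in> V\<close> that] by (simp add: pairs_with_sum_def)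
      show "p \<inter> q = {}" if "p \<in> T v" "q \<in> T v" "p \<noteq> q" for p q
        using that by (auto simp: T_def)
    qed (simp_all add: finite_bit_vec T_def)
    ultimately show ?thesis using Union_T[OF that] by simp
  qed
  \<comment> \<open>Every element of \<open>L v\<close> is a difference of two elements of \<open>U v\<close>.\<close>
  have sub: "L v \<subseteq> L v'" if "v \<in> V" "v' \<in> V" "U v = U v'" for v v'
  proof
    fix x assume x: "x \<in> L v"
    \<comment> \<open>Avoiding \<open>0\<close> and \<open>w\<close> puts \<open>v + y\<close> into
      \<open>U v\<close>; avoiding \<open>x\<close> and \<open>x + w\<close> does the same for
      \<open>v + (y + x)\<close>.\<close>
    have "card {0, w, x, x + w} \<le> 4" by (simp add: card_insert_if)
    then have "card (L v - {0, w, x, x + w}) > 0"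
      using diff_card_le_card_Diff[of "{0, w, x, x + w}" "L v"] by (simp add: L(2))
    then obtain y where y: "y \<in> L v" "y \<notin> {0, w, x, x + w}"
      by (metis Diff_iff card_gt_0_iff equals0I)
    have "y + x \<in> L v" using y(1) x by (rule vec.subspace_add[OF L(1)])
    moreover have "y + x \<noteq> w" using y(2) by (metis add.commute bit_vec_add_self_left insertCI)
    moreover have "y + x \<noteq> 0" using y(2) by auto
    ultimately have "v + y \<in> U v" "v + (y + x) \<in> U v"
      using y by (auto simp: U_def)
    then have "v' + (v + y) \<in> L v'" "v' + (v + (y + x)) \<in> L v'"
      unfolding that(3) by (auto simp: U_iff)
    then have "(v' + (v + y)) + (v' + (v + (y + x))) \<in> L v'"
      using vec.subspace_add[OF L(1)] by blast
    then show "x \<in> L v'" by (simp add: bit_vec_add_cancel)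
  qed
  have "inj_on T V"
  proof (rule inj_onI)
    fix v v' assume v: "v \<in> V" "v' \<in> V" and "T v = T v'"
    then have U: "U v = U v'" using Union_T by metis
    then have LL: "L v = L v'" using sub v by blast
    have "U v \<noteq> {}" using card_T[OF v(1)] by (auto simp: T_def)
    then obtain u where "u \<in> U v" by auto
    then have "u + v \<in> L v" "u + v' \<in> L v" using U LL by (metis U_iff add.commute)+
    then have "(u + v) + (u + v') \<in> L v" using vec.subspace_add[OF L(1)] by blast
    then have "v + v' \<in> L v" by (simp add: bit_vec_add_cancel)
    \<comment> \<open>Within the coset \<open>v + L v\<close>, only \<open>v\<close> and
      \<open>v + w\<close> lie outside \<open>U v\<close>.\<close>
    moreover have "v' \<notin> U v" unfolding U by (simp add: U_iff)
    ultimately have "v' = v \<or> v' = v + w" by (auto simp: U_iff)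
    \<comment> \<open>\<open>v\<close> and \<open>v + w\<close> have the same pairs; this is where \<open>V \<inter> C = {}\<close> is needed.\<close>
    moreover have "v + w \<in> C" using L(3)[OF V(2)[OF v(1)] \<open>w \<noteq> 0\<close>] .
    then have "v' \<noteq> v + w" using V(1)[OF v(2)] by auto
    ultimately show "v = v'" by simp
  qed
  have fin: "finite {t. t \<subseteq> pairs_with_sum C w \<and> card t = 3}"
    by (rule finite_subset[of _ "Pow (pairs_with_sum C w)"]) (auto simp: finite_pairs_with_sum)
  have "card V = card (T ` V)" using \<open>inj_on T V\<close> by (simp add: card_image)
  also have "\<dots> \<le> card {t. t \<subseteq> pairs_with_sum C w \<and> card t = 3}"
    using T_mem card_T by (intro card_mono[OF fin]) blast
  also have "\<dots> = card (pairs_with_sum C w) choose 3"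
    by (rule n_subsets) (rule finite_pairs_with_sum)
  finally show ?thesis .
qed

lemma card_fixed_direction_le_card:
  fixes C V :: "(bit ^ 'r::finite) set"
  assumes "\<And>v. v \<in> V \<Longrightarrow> v + w \<in> C"
  shows "card V \<le> card C"
  using assms by (intro card_inj_on_le[of "\<lambda>v. v + w"]) (auto simp: finite_bit_vec)

text \<open>Since \<open>k choose 3\<close> is at most \<open>k ^ 3 / 6\<close>, it suffices that
  the smaller of \<open>k ^ 3\<close> and \<open>x ^ 3\<close> is at most \<open>k * x ^ 2\<close>.
  Being linear in \<open>k\<close>, this bound can be summed over all directions.\<close>

lemma min_card_choose_3_le:
  assumes "real m \<le> x ^ 3 / 6" "m \<le> k choose 3" "x \<ge> 0"
  shows "real m \<le> real k * x\<^sup>2 / 6"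
proof (cases "real k \<le> x")
  case True
  have "real m \<le> real (k choose 3)" using assms by simp
  also have "\<dots> \<le> real k * (real k)\<^sup>2 / 6"
    using of_nat_mono[OF binomial_fact_pow[of k 3], where 'a = real]
    by (simp add: fact_numeral power3_eq_cube power2_eq_square)
  also have "\<dots> \<le> real k * x\<^sup>2 / 6"
    using True by (intro divide_right_mono mult_left_mono power_mono) auto
  finally show ?thesis .
next
  case False
  have "real m \<le> x * x\<^sup>2 / 6" using assms by (simp add: power3_eq_cube power2_eq_square)
  also have "\<dots> \<le> real k * x\<^sup>2 / 6"
    using False by (intro divide_right_mono mult_right_mono) auto
  finally show ?thesis .
qed

section \<open>Double counting of points and directions\<close>

text \<open>The pairs of a point \<open>v \<notin> C\<close> and a nonzero
  \<open>w \<in> L v\<close> are counted by \<open>v\<close> and by \<open>w\<close>.\<close>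

lemma d_complete_3_card_bound:
  fixes C :: "(bit ^ 'r::finite) set"
  assumes "d_complete 3 C" "x ^ 3 = 6 * real (card C)" "x \<ge> 0"
  shows "7 * (2 ^ CARD('r) - real (card C)) \<le> real (card C) * (real (card C) - 1) * x\<^sup>2 / 12"
proof -
  obtain L where L: "\<And>v. vec.subspace (L v)" "\<And>v. vec.dim (L v) = 3"
      "\<And>v. (\<lambda>x. v + x) ` (L v - {0}) \<subseteq> C"
    using assms(1) unfolding d_complete_def by metis
  have card_L: "card (L v) = 8" for v using card_subspace_bit[OF L(1)] L(2) by simp
  have LC: "v + x \<in> C" if "x \<in> L v" "x \<noteq> 0" for v x using that L(3) by blast
  define V where "V w = {v \<in> - C. w \<in> L v}" for w
  define k where "k w = card (pairs_with_sum C w)" for w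
  have V: "real (card (V w)) \<le> real (k w) * x\<^sup>2 / 6" if "w \<noteq> 0" for w
  proof (rule min_card_choose_3_le)
    have "card (V w) \<le> card C"
      by (rule card_fixed_direction_le_card[of _ w]) (use LC that in \<open>auto simp: V_def\<close>)
    then show "real (card (V w)) \<le> x ^ 3 / 6" using assms by simp
    show "card (V w) \<le> k w choose 3"
      unfolding k_def
      by (rule card_fixed_direction_le_choose[where L = L])
         (use that LC L card_L in \<open>auto simp: V_def\<close>)
  qed (use assms in simp)
  have "card {w \<in> - {0}. w \<in> L v} = 7" for v
  proof -
    have "{w \<in> - {0}. w \<in> L v} = L v - {0}" by auto
    then show ?thesis using vec.subspace_0[OF L(1)] by (simp add: card_L)
  qed
  then have "7 * card (- C) = (\<Sum>v\<in>- C. card {w \<in> - {0}. w \<in> L v})" by simp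
  also have "\<dots> = (\<Sum>w\<in>- {0}. card (V w))"
    by (rule sum_multicount_gen) (auto simp: finite_bit_vec V_def)
  finally have "7 * real (card (- C)) = (\<Sum>w\<in>- {0}. real (card (V w)))"
    by (metis of_nat_mult of_nat_numeral of_nat_sum)
  also have "\<dots> \<le> (\<Sum>w\<in>- {0}. real (k w) * x\<^sup>2 / 6)"
    using V by (intro sum_mono) auto
  also have "\<dots> = real (\<Sum>w\<in>- {0}. k w) * (x\<^sup>2 / 6)"
    by (simp add: sum_distrib_right)
  also have "\<dots> \<le> real (card C choose 2) * (x\<^sup>2 / 6)"
    using sum_card_pairs_with_sum_le[of C "- {0}"] unfolding k_def
    by (intro mult_right_mono of_nat_mono) auto
  \<comment> \<open>\<open>choose_two\<close> has a truncated subtraction, so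
    \<open>card C = 0\<close> is treated separately.\<close>
  also have "real (card C choose 2) = real (card C) * (real (card C) - 1) / 2"
    by (cases "card C") (simp_all add: choose_two real_of_nat_div algebra_simps)
  also have "real (card (- C)) = 2 ^ CARD('r) - real (card C)"
    using card_mono[of UNIV C]
    by (simp add: finite_bit_vec card_bit of_nat_diff Compl_eq_Diff_UNIV card_Diff_subset)
  finally show ?thesis by simp
qed

section \<open>Numerical estimates and conclusion\<close>

lemma card_power_8_bound:
  fixes n N x :: real
  assumes "7 * (N - n) \<le> n * (n - 1) * x\<^sup>2 / 12" "x ^ 3 = 6 * n" "x \<ge> 0" "N \<ge> 2 ^ 15"
  shows "16464 * N ^ 3 < n ^ 8"
proof -
  have "n \<ge> 0" using assms(2,3) zero_le_power[of x 3] by simp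
  have x6: "(x\<^sup>2) ^ 3 = 36 * n\<^sup>2"
  proof -
    have "(x\<^sup>2) ^ 3 = (x ^ 3)\<^sup>2" by (simp flip: power_mult)
    then show ?thesis by (simp add: assms(2) power_mult_distrib)
  qed
  \<comment> \<open>The threshold 130 ensures \<open>36 * n ^ 2 > 84 ^ 3\<close>, hence
    \<open>x ^ 2 > 84\<close>. Below it, the right side of the first assumption is less than 141000,
    while the left exceeds \<open>7 * (2 ^ 15 - 130)\<close>, which is more than 228000.\<close>
  have "n \<ge> 130"
  proof (rule ccontr)
    assume n: "\<not> n \<ge> 130"
    have "x < 10" using n assms(2,3) power_less_imp_less_base[of x 3 10] by simp
    then have "x\<^sup>2 \<le> 10\<^sup>2" using assms(3) by (intro power_mono) auto
    moreover have "n * (n - 1) \<le> 130 * 130"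
    proof (cases "n \<ge> 1")
      case True
      then show ?thesis using n by (intro mult_mono) auto
    next
      case False
      then have "n * (n - 1) \<le> 0" using \<open>n \<ge> 0\<close> by (simp add: mult_nonneg_nonpos)
      then show ?thesis by simp
    qed
    ultimately have "n * (n - 1) * x\<^sup>2 \<le> (130 * 130) * 10\<^sup>2"
      using mult_mono[of "n * (n - 1)" "130 * 130" "x\<^sup>2" "10\<^sup>2"] by simp
    then show False using n assms(1,4) by simp
  qed
  have "x\<^sup>2 > 84"
  proof (rule power_less_imp_less_base)
    have "(130::real)\<^sup>2 \<le> n\<^sup>2" using \<open>n \<ge> 130\<close> by (intro power_mono) auto
    then show "84 ^ 3 < (x\<^sup>2) ^ 3" unfolding x6 by simp
  qed simp
  \<comment> \<open>Multiplied by 12, the first assumption bounds \<open>84 * N\<close> by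
    \<open>n ^ 2 * x ^ 2 + (84 - x ^ 2) * n\<close>, whose last term is negative.\<close>
  then have "n * 84 < n * x\<^sup>2" using \<open>n \<ge> 130\<close> by simp
  then have "84 * N < n\<^sup>2 * x\<^sup>2"
    using assms(1) by (simp add: algebra_simps power2_eq_square)
  then have "(84 * N) ^ 3 < (n\<^sup>2 * x\<^sup>2) ^ 3"
    using assms(4) by (intro power_strict_mono) auto
  also have "\<dots> = n ^ 6 * (36 * n\<^sup>2)"
    by (simp only: power_mult_distrib x6) (simp flip: power_mult)
  also have "\<dots> = 36 * n ^ 8" by (simp flip: power_add)
  finally show ?thesis by (simp add: power_mult_distrib)
qed

theorem theorem3:
  assumes "CARD('r::finite) \<ge> 15"
  shows "real (\<gamma> TYPE('r::finite) 3) > 16464 powr (1/8) * 2 powr (3 * real CARD('r) / 8)"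
proof -
  obtain C :: "(bit ^ 'r) set" where C: "d_complete 3 C" "card C = \<gamma> TYPE('r) 3"
    using \<gamma>_attained[where 'r = 'r, of 3] assms by auto
  let ?n = "real (\<gamma> TYPE('r) 3)"
  \<comment> \<open>Comparing eighth powers removes the fractional exponents.\<close>
  have "16464 * (2 ^ CARD('r)) ^ 3 < ?n ^ 8"
  proof (rule card_power_8_bound)
    show "7 * (2 ^ CARD('r) - ?n) \<le> ?n * (?n - 1) * (root 3 (6 * ?n))\<^sup>2 / 12"
      using d_complete_3_card_bound[OF C(1), of "root 3 (6 * ?n)"] by (simp add: C(2))
    show "(2::real) ^ 15 \<le> 2 ^ CARD('r)" using assms by (intro power_increasing) auto
  qed auto
  moreover have "(16464 powr (1/8) * 2 powr (3 * real CARD('r) / 8)) ^ 8 = 16464 * (2 ^ CARD('r)) ^ 3"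
  proof -
    have "(2 powr (3 * real CARD('r) / 8)) ^ 8 = (2::real) powr (real (CARD('r) * 3))"
      by (simp add: powr_power mult.commute)
    then show ?thesis
      by (simp only: power_mult_distrib powr_realpow power_mult) (simp add: powr_power)
  qed
  ultimately have "(16464 powr (1/8) * 2 powr (3 * real CARD('r) / 8)) ^ 8 < ?n ^ 8"
    by (simp only:)
  then show ?thesis by (rule power_less_imp_less_base) (rule of_nat_0_le_iff)
qed

end
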